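(* Let $D$ be a (possibly infinite) set and let $\varphi:D^3\to D$ satisfy $\varphi(x,x,y)=\varphi(y,x,x)=y$ for all $x,y\in D$. Then there exist operations $f_1,f_3,f_5,\dots$, with $f_m:D^m\to D$, all belonging to the clone generated by $\varphi$, which satisfy the Catalan identities. Conversely, if a sequence of operations $f_1,f_3,\dots$ on $D$ (with $f_m$ of arity $m$) satisfies the Catalan identities, then $f_3$ satisfies $f_3(x,x,y)=f_3(y,x,x)=y$ for all $x,y\in D$.
   Context: The clone generated by $\varphi$ is the smallest set of finitary operations on $D$ containing $\varphi$ and all projections $(x_1,\dots,x_n)\mapsto x_i$ and closed under composition $f\circ(g_1,\dots,g_n)$. A sequence $(\psi_m)_{m\text{ odd}}$ with $\psi_m:D^m\to D$ satisfies the Catalan identities if $\psi_1(x)=x$ for all $x$, and for every odd $m\ge3$, every $i\in[m-1]$ and all $x_1,\dots,x_m\in D$ with $x_i=x_{i+1}$ we have $\psi_m(x_1,\dots,x_m)=\psi_{m-2}(x_1,\dots,x_{i-1},x_{i+2},\dots,x_m)$. *)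

theory Defs
  imports "HOL-Library.FuncSet"
begin

text \<open>
  The underlying set is a carrier \<open>D\<close>, which may be infinite or empty. An element of \<open>D^n\<close> is a
  list of length \<open>n\<close> over \<open>D\<close>.
\<close>

definition tuples :: "'a set \<Rightarrow> nat \<Rightarrow> 'a list set" where
  "tuples D n = {xs. length xs = n \<and> set xs \<subseteq> D}"

text \<open>
  Using \<open>\<rightarrow>\<^sub>E\<close>, the maps \<open>D^n \<rightarrow> D\<close> correspond one-to-one to the elements of \<open>operations D n\<close>, so
  that equality of operations is equality in HOL.
\<close>

definition operations :: "'a set \<Rightarrow> nat \<Rightarrow> ('a list \<Rightarrow> 'a) set" where
  "operations D n = tuples D n \<rightarrow>\<^sub>E D"

definition proj_op :: "'a set \<Rightarrow> nat \<Rightarrow> nat \<Rightarrow> 'a list \<Rightarrow> 'a" where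
  "proj_op D n i = restrict (\<lambda>xs. xs ! i) (tuples D n)"

text \<open>
  The composition \<open>f \<circ> (g\<^sub>1, \<dots>, g\<^sub>n)\<close>, where \<open>gs = [g\<^sub>1, \<dots>, g\<^sub>n]\<close> and all \<open>g\<^sub>j\<close> have the same arity \<open>k\<close>.
\<close>

definition comp_op ::
    "'a set \<Rightarrow> nat \<Rightarrow> ('a list \<Rightarrow> 'a) \<Rightarrow> ('a list \<Rightarrow> 'a) list \<Rightarrow> 'a list \<Rightarrow> 'a" where
  "comp_op D k f gs = restrict (\<lambda>xs. f (map (\<lambda>g. g xs) gs)) (tuples D k)"

text \<open>
  The clone on \<open>D\<close> generated by a set \<open>F\<close> of finitary operations. The arity is recorded explicitly,
  because it cannot always be recovered from the underlying HOL function: \<open>(n, f)\<close> stands for the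
  \<open>n\<close>-ary operation \<open>f\<close>.
\<close>

inductive_set clone ::
    "'a set \<Rightarrow> (nat \<times> ('a list \<Rightarrow> 'a)) set \<Rightarrow> (nat \<times> ('a list \<Rightarrow> 'a)) set"
  for D :: "'a set" and F :: "(nat \<times> ('a list \<Rightarrow> 'a)) set" where
  generator: "(n, f) \<in> F \<Longrightarrow> (n, f) \<in> clone D F"
| projection: "i < n \<Longrightarrow> (n, proj_op D n i) \<in> clone D F"
| composition: "(n, f) \<in> clone D F \<Longrightarrow> length gs = n \<Longrightarrow> \<forall>g\<in>set gs. (k, g) \<in> clone D F
    \<Longrightarrow> (k, comp_op D k f gs) \<in> clone D F"

text \<open>
  Indices \<open>i\<close> are 1-based here, whereas \<open>!\<close> is 0-based: \<open>x\<^sub>i\<close> is \<open>xs ! (i - 1)\<close> and \<open>x\<^bsub>i+1\<^esub>\<close> is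
  \<open>xs ! i\<close>. The values of \<open>\<psi>\<close> at even indices are irrelevant.
\<close>

definition catalan_identities :: "'a set \<Rightarrow> (nat \<Rightarrow> 'a list \<Rightarrow> 'a) \<Rightarrow> bool" where
  "catalan_identities D \<psi> \<longleftrightarrow>
     (\<forall>x\<in>D. \<psi> 1 [x] = x) \<and>
     (\<forall>m. odd m \<and> 3 \<le> m \<longrightarrow>
        (\<forall>i\<in>{1..m - 1}. \<forall>xs\<in>tuples D m. xs ! (i - 1) = xs ! i \<longrightarrow>
           \<psi> m xs = \<psi> (m - 2) (take (i - 1) xs @ drop (i + 1) xs)))"

end

theory Submission imports Defs begin

text \<open>
  Once \<open>f\<^bsub>m-2\<^esub>\<close> is known, the Catalan identities prescribe \<open>f\<^sub>m\<close> on each diagonal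
  \<open>A\<^sub>k = {x. x\<^sub>k = x\<^bsub>k+1\<^esub>}\<close>: there it must equal \<open>h\<^sub>k\<close>, which deletes \<open>x\<^sub>k, x\<^bsub>k+1\<^esub>\<close> and applies
  \<open>f\<^bsub>m-2\<^esub>\<close>. These prescriptions agree on overlaps, and they are glued as in the proof that
  simplicial Mal'cev algebras satisfy the Kan condition. The map \<open>r\<^sub>k\<close> replacing \<open>x\<^bsub>k+1\<^esub>\<close> by
  \<open>x\<^sub>k\<close> retracts onto \<open>A\<^sub>k\<close> and preserves \<open>A\<^sub>j\<close> for all \<open>j < k\<close>. Hence, if \<open>w\<close> is correct on all
  \<open>A\<^sub>j\<close> with \<open>j < k\<close>, then \<open>\<phi>(w, w \<circ> r\<^sub>k, h\<^sub>k)\<close> is correct on \<open>A\<^sub>k\<close> as well: it is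
  \<open>\<phi>(w, w, h\<^sub>k) = h\<^sub>k\<close> on \<open>A\<^sub>k\<close>, and \<open>\<phi>(w, h\<^sub>k, h\<^sub>k) = w\<close> on \<open>A\<^sub>j\<close>.
\<close>

text \<open>Positions are 0-based, so \<open>k\<close> stands for i - 1 when i is the index in
  \<open>catalan_identities\<close>.\<close>

definition delete_pair :: "nat \<Rightarrow> 'a list \<Rightarrow> 'a list" where
  "delete_pair k xs = take k xs @ drop (k + 2) xs"

text \<open>Stage \<open>k\<close> is the one at which the diagonals below \<open>k\<close> have
  been treated. No condition is imposed at stage 0, so \<open>xs ! 0\<close> is just a convenient
  projection to start from.\<close>

fun glue :: "('a list \<Rightarrow> 'a) \<Rightarrow> ('a list \<Rightarrow> 'a) \<Rightarrow> nat \<Rightarrow> 'a list \<Rightarrow> 'a" where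
  "glue \<phi> h 0 xs = xs ! 0"
| "glue \<phi> h (Suc k) xs =
     \<phi> [glue \<phi> h k xs, glue \<phi> h k (xs[Suc k := xs ! k]), h (delete_pair k xs)]"

text \<open>The operation \<open>catalan_op \<phi> n\<close> has arity \<open>2n + 1\<close>.\<close>

fun catalan_op :: "('a list \<Rightarrow> 'a) \<Rightarrow> nat \<Rightarrow> 'a list \<Rightarrow> 'a" where
  "catalan_op \<phi> 0 xs = xs ! 0"
| "catalan_op \<phi> (Suc n) xs = glue \<phi> (catalan_op \<phi> n) (2 * n + 2) xs"

section \<open>Deleting adjacent pairs\<close>

lemma delete_pair_in_tuples:
  assumes "xs \<in> tuples D (m + 2)" "k \<le> m"
  shows "delete_pair k xs \<in> tuples D m"
  using assms set_take_subset[of k xs] set_drop_subset[of "k + 2" xs]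
  by (auto simp: tuples_def delete_pair_def)

text \<open>Once the pair at \<open>j\<close> is gone, every later position moves down by 2. Writing
  the later position as \<open>j + 2 + d\<close> makes the pairs disjoint and avoids
  subtraction.\<close>

lemma delete_pair_commute:
  assumes "j + 2 + d \<le> length xs"
  shows "delete_pair (j + d) (delete_pair j xs) = delete_pair j (delete_pair (j + 2 + d) xs)"
  using assms by (simp add: delete_pair_def drop_take min_def ac_simps)

text \<open>The two deletions differ only in whether \<open>xs ! Suc (Suc j)\<close> or
  \<open>xs ! j\<close> survives.\<close>

lemma delete_pair_adjacent:
  assumes "Suc (Suc j) < length xs" "xs ! j = xs ! Suc (Suc j)"
  shows "delete_pair j xs = delete_pair (Suc j) xs"
  using assms by (simp add: delete_pair_def take_Suc_conv_app_nth Cons_nth_drop_Suc)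

lemma nth_delete_pair:
  assumes "k + 2 \<le> length xs"
  shows "delete_pair k xs ! i = (if i < k then xs ! i else xs ! (i + 2))"
  using assms by (simp add: delete_pair_def nth_append)

lemma list_update_in_tuples:
  assumes "xs \<in> tuples D m" "x \<in> D"
  shows "xs[i := x] \<in> tuples D m"
  using assms set_update_subset_insert[of xs i x] by (auto simp: tuples_def)

lemma nth_in_tuples: "xs \<in> tuples D m \<Longrightarrow> i < m \<Longrightarrow> xs ! i \<in> D"
  by (auto simp: tuples_def)

section \<open>Operations in a clone\<close>

lemma clone_subset_operations:
  assumes "(n, f) \<in> clone D F" "\<And>n f. (n, f) \<in> F \<Longrightarrow> f \<in> operations D n"
  shows "f \<in> operations D n"
  using assms(1)
proof induction
  case (generator n f)
  then show ?case by (rule assms(2))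
next
  case (projection i n)
  then show ?case by (auto simp: operations_def proj_op_def nth_in_tuples)
next
  case (composition n f gs k)
  have "map (\<lambda>g. g xs) gs \<in> tuples D n" if "xs \<in> tuples D k" for xs
    using composition that by (fastforce simp: tuples_def operations_def)
  then show ?case
    using composition by (auto simp: operations_def comp_op_def)
qed

text \<open>Composing with projections realizes any substitution of variables, with repetitions and
  omissions allowed. Retractions and deletions of pairs are both of this form.\<close>

lemma clone_substitute_variables:
  assumes "(n, restrict f (tuples D n)) \<in> clone D F" "length is = n" "\<forall>i\<in>set is. i < k"
  shows "(k, restrict (\<lambda>xs. f (map ((!) xs) is)) (tuples D k)) \<in> clone D F"
proof -
  have "(k, comp_op D k (restrict f (tuples D n)) (map (proj_op D k) is)) \<in> clone D F"
    using assms by (intro clone.composition) (auto intro: clone.projection)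
  also have "comp_op D k (restrict f (tuples D n)) (map (proj_op D k) is) =
      restrict (\<lambda>xs. f (map ((!) xs) is)) (tuples D k)"
  proof (unfold comp_op_def, rule restrict_ext)
    fix xs assume xs: "xs \<in> tuples D k"
    then have "map ((!) xs) is \<in> tuples D n"
      using assms(2,3) by (auto simp: tuples_def)
    with xs show "restrict f (tuples D n) (map (\<lambda>g. g xs) (map (proj_op D k) is)) =
        f (map ((!) xs) is)"
      by (simp add: proj_op_def comp_def)
  qed
  finally show ?thesis .
qed

section \<open>Gluing along the diagonals\<close>

locale malcev =
  fixes D :: "'a set" and \<phi> :: "'a list \<Rightarrow> 'a"
  assumes \<phi>_op: "\<phi> \<in> operations D 3"
    and \<phi>_left: "x \<in> D \<Longrightarrow> y \<in> D \<Longrightarrow> \<phi> [x, x, y] = y"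
    and \<phi>_right: "x \<in> D \<Longrightarrow> y \<in> D \<Longrightarrow> \<phi> [y, x, x] = y"
begin

lemma \<phi>_closed: "x \<in> D \<Longrightarrow> y \<in> D \<Longrightarrow> z \<in> D \<Longrightarrow> \<phi> [x, y, z] \<in> D"
  using \<phi>_op by (auto simp: operations_def tuples_def)

lemma glue_closed:
  assumes "\<And>ys. ys \<in> tuples D m \<Longrightarrow> h ys \<in> D" "k \<le> Suc m" "xs \<in> tuples D (m + 2)"
  shows "glue \<phi> h k xs \<in> D"
  using assms(2,3)
proof (induction k arbitrary: xs)
  case 0
  then show ?case by (simp add: nth_in_tuples)
next
  case (Suc k)
  have "xs[Suc k := xs ! k] \<in> tuples D (m + 2)"
    using Suc.prems by (intro list_update_in_tuples nth_in_tuples) auto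
  with Suc show ?case
    by (auto intro!: \<phi>_closed assms(1) delete_pair_in_tuples)
qed

text \<open>Induction on the number \<open>k\<close> of diagonals treated; a tuple of length m + 2
  has m + 1 of them. \<open>xs\<close> is generalized since the induction hypothesis is also needed
  at the retracted tuple. Agreement on overlaps enters as \<open>compat\<close>.\<close>

lemma glue_diagonal:
  assumes h_closed: "\<And>ys. ys \<in> tuples D m \<Longrightarrow> h ys \<in> D"
    and compat: "\<And>j k xs. j < k \<Longrightarrow> k \<le> m \<Longrightarrow> xs \<in> tuples D (m + 2) \<Longrightarrow>
      xs ! j = xs ! Suc j \<Longrightarrow> xs ! k = xs ! Suc k \<Longrightarrow>
      h (delete_pair j xs) = h (delete_pair k xs)"
    and "k \<le> Suc m" "j < k" "xs \<in> tuples D (m + 2)" "xs ! j = xs ! Suc j"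
  shows "glue \<phi> h k xs = h (delete_pair j xs)"
  using assms(3-)
proof (induction k arbitrary: xs)
  case 0
  then show ?case by simp
next
  case (Suc k)
  have xs: "xs \<in> tuples D (m + 2)" and k: "k \<le> m"
    using Suc.prems by auto
  have h: "h (delete_pair i xs) \<in> D" if "i \<le> m" for i
    using h_closed delete_pair_in_tuples[OF xs that] .
  have len: "length xs = m + 2"
    using xs by (simp add: tuples_def)
  show ?case
  proof (cases "j = k")
    case True
    \<comment> \<open>On its own diagonal the retraction is the identity, so the first two arguments
      of \<open>\<phi>\<close> coincide.\<close>
    then have "xs[Suc k := xs ! k] = xs"
      using Suc.prems by simp
    moreover have "glue \<phi> h k xs \<in> D"
      using glue_closed[OF h_closed _ xs] k by simp
    ultimately show ?thesis
      using True h k by (simp add: \<phi>_left)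
  next
    case False
    then have j: "j < k"
      using Suc.prems by simp
    \<comment> \<open>The retracted tuple differs from \<open>xs\<close> at most at position k + 1 >
      j + 1, so it lies on both diagonals \<open>j\<close> and \<open>k\<close>.\<close>
    define ys where "ys = xs[Suc k := xs ! k]"
    have ys: "ys \<in> tuples D (m + 2)"
      unfolding ys_def using xs k by (intro list_update_in_tuples nth_in_tuples) auto
    have ys_eq: "ys ! j = ys ! Suc j" "ys ! k = ys ! Suc k"
      using Suc.prems j k len by (simp_all add: ys_def)
    have "glue \<phi> h k ys = h (delete_pair j ys)"
      using Suc.IH[OF _ j ys ys_eq(1)] k by simp
    also have "\<dots> = h (delete_pair k ys)"
      by (rule compat[OF j k ys ys_eq])
    \<comment> \<open>The only modified entry is among those deleted.\<close>
    also have "delete_pair k ys = delete_pair k xs"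
      by (simp add: delete_pair_def ys_def)
    finally have "glue \<phi> h (Suc k) xs = \<phi> [glue \<phi> h k xs, h (delete_pair k xs), h (delete_pair k xs)]"
      by (simp add: ys_def)
    also have "glue \<phi> h k xs = h (delete_pair j xs)"
      using Suc.IH[OF _ j xs] Suc.prems k by simp
    finally show ?thesis
      using h j k by (simp add: \<phi>_right)
  qed
qed

section \<open>The identities for \<open>catalan_op\<close>\<close>

lemma catalan_op_closed: "xs \<in> tuples D (2 * n + 1) \<Longrightarrow> catalan_op \<phi> n xs \<in> D"
proof (induction n arbitrary: xs)
  case 0
  then show ?case by (simp add: nth_in_tuples)
next
  case (Suc n)
  then show ?case
    using glue_closed[of "2 * n + 1" "catalan_op \<phi> n" "2 * n + 2" xs] by simp
qed

text \<open>The prescriptions for arity 2n + 3 agree on overlaps because the identities hold one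
  level below: for disjoint pairs, both sides reduce to the value of \<open>catalan_op\<close> after
  deleting both pairs. Overlapping pairs leave the same tuple.\<close>

lemma catalan_op_diagonal:
  assumes "xs \<in> tuples D (2 * n + 3)" "k \<le> 2 * n + 1" "xs ! k = xs ! Suc k"
  shows "catalan_op \<phi> (Suc n) xs = catalan_op \<phi> n (delete_pair k xs)"
  using assms
proof (induction n arbitrary: k xs rule: less_induct)
  case (less n)
  have compat: "catalan_op \<phi> n (delete_pair i ys) = catalan_op \<phi> n (delete_pair j ys)"
    if "i < j" and j_le: "j \<le> 2 * n + 1" and ys: "ys \<in> tuples D (2 * n + 1 + 2)"
      and ij: "ys ! i = ys ! Suc i" "ys ! j = ys ! Suc j" for i j ys
  proof (cases "j = Suc i")
    case True
    with that have "delete_pair i ys = delete_pair j ys"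
      using delete_pair_adjacent[of i ys] by (auto simp: tuples_def)
    then show ?thesis by simp
  next
    case False
    then obtain d where j: "j = i + 2 + d"
      using \<open>i < j\<close> by (metis Suc_leI add_2_eq_Suc' le_Suc_ex le_neq_implies_less)
    \<comment> \<open>Disjoint pairs force j \<ge> 2, which excludes n = 0.\<close>
    obtain p where n: "n = Suc p"
      using j j_le by (cases n) auto
    have len: "length ys = 2 * p + 5" and jp: "j \<le> 2 * p + 3"
      using ys j_le by (simp_all add: tuples_def n)
    have del: "delete_pair l ys \<in> tuples D (2 * p + 3)" if "l \<le> 2 * n + 1" for l
      using delete_pair_in_tuples[OF ys that] by (simp add: n numeral_3_eq_3)
    have "catalan_op \<phi> (Suc p) (delete_pair i ys) =
        catalan_op \<phi> p (delete_pair (i + d) (delete_pair i ys))"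
    proof (rule less.IH)
      show "delete_pair i ys ! (i + d) = delete_pair i ys ! Suc (i + d)"
        using ij(2) j jp len by (simp add: nth_delete_pair)
    qed (use del j jp n in auto)
    also have "delete_pair (i + d) (delete_pair i ys) = delete_pair i (delete_pair j ys)"
      unfolding j using j jp len by (intro delete_pair_commute) simp
    also have "catalan_op \<phi> p \<dots> = catalan_op \<phi> (Suc p) (delete_pair j ys)"
    proof (rule less.IH[symmetric])
      show "delete_pair j ys ! i = delete_pair j ys ! Suc i"
        using ij(1) j jp len by (simp add: nth_delete_pair)
    qed (use del j jp n in auto)
    finally show ?thesis by (simp only: n)
  qed
  show ?case
    \<comment> \<open>A tuple of length 2n + 3 has 2n + 2 diagonals, so the last stage covers them
      all.\<close>
    using glue_diagonal[of "2 * n + 1" "catalan_op \<phi> n" "2 * n + 2" k xs]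
      catalan_op_closed compat less.prems
    by (simp add: numeral_3_eq_3)
qed

section \<open>Membership in the clone\<close>

lemma clone_apply:
  assumes "(k, restrict a (tuples D k)) \<in> clone D {(3, \<phi>)}"
    "(k, restrict b (tuples D k)) \<in> clone D {(3, \<phi>)}"
    "(k, restrict c (tuples D k)) \<in> clone D {(3, \<phi>)}"
  shows "(k, restrict (\<lambda>xs. \<phi> [a xs, b xs, c xs]) (tuples D k)) \<in> clone D {(3, \<phi>)}"
proof -
  have "(k, comp_op D k \<phi> (map (\<lambda>g. restrict g (tuples D k)) [a, b, c])) \<in> clone D {(3, \<phi>)}"
    using assms by (intro clone.composition[of 3] clone.generator) auto
  also have "comp_op D k \<phi> (map (\<lambda>g. restrict g (tuples D k)) [a, b, c]) =
      restrict (\<lambda>xs. \<phi> [a xs, b xs, c xs]) (tuples D k)"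
    by (auto simp: comp_op_def intro: restrict_ext)
  finally show ?thesis .
qed

lemma glue_in_clone:
  assumes h: "(m, restrict h (tuples D m)) \<in> clone D {(3, \<phi>)}" and "k \<le> Suc m"
  shows "(m + 2, restrict (glue \<phi> h k) (tuples D (m + 2))) \<in> clone D {(3, \<phi>)}"
  using assms(2)
proof (induction k)
  case 0
  have "restrict (glue \<phi> h 0) (tuples D (m + 2)) = proj_op D (m + 2) 0"
    by (auto simp: proj_op_def)
  moreover have "(m + 2, proj_op D (m + 2) 0) \<in> clone D {(3, \<phi>)}"
    by (rule clone.projection) simp
  ultimately show ?case by (simp only:)
next
  case (Suc k)
  \<comment> \<open>Applying the retraction and the deletion to the list of indices yields the
    corresponding substitutions of variables.\<close>
  let ?is = "[0..<m + 2][Suc k := k]" and ?js = "delete_pair k [0..<m + 2]"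
  have IH: "(m + 2, restrict (glue \<phi> h k) (tuples D (m + 2))) \<in> clone D {(3, \<phi>)}"
    by (rule Suc.IH) (use Suc.prems in simp)
  have bound: "\<forall>i\<in>set ?is. i < m + 2" "\<forall>i\<in>set ?js. i < m + 2"
    using Suc.prems set_update_subset_insert[of "[0..<m + 2]" "Suc k" k]
    by (auto simp: delete_pair_def dest: in_set_takeD in_set_dropD simp del: upt_Suc)
  have len: "length ?is = m + 2" "length ?js = m"
    using Suc.prems by (simp_all add: delete_pair_def)
  have "(m + 2, restrict (\<lambda>xs. \<phi> [glue \<phi> h k xs, glue \<phi> h k (map ((!) xs) ?is),
      h (map ((!) xs) ?js)]) (tuples D (m + 2))) \<in> clone D {(3, \<phi>)}"
    using IH h bound len by (intro clone_apply clone_substitute_variables[of "m + 2"]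
        clone_substitute_variables[of m])
  also have "restrict (\<lambda>xs. \<phi> [glue \<phi> h k xs, glue \<phi> h k (map ((!) xs) ?is),
      h (map ((!) xs) ?js)]) (tuples D (m + 2)) = restrict (glue \<phi> h (Suc k)) (tuples D (m + 2))"
  proof (rule restrict_ext)
    fix xs assume "xs \<in> tuples D (m + 2)"
    then have len: "length xs = m + 2"
      by (simp add: tuples_def)
    then have "map ((!) xs) [0..<m + 2] = xs"
      by (metis map_nth)
    then have "map ((!) xs) ?is = xs[Suc k := xs ! k]" "map ((!) xs) ?js = delete_pair k xs"
      by (simp_all add: map_update delete_pair_def take_map[symmetric] drop_map[symmetric]
          del: upt_Suc take_upt drop_upt)
    then show "\<phi> [glue \<phi> h k xs, glue \<phi> h k (map ((!) xs) ?is), h (map ((!) xs) ?js)] =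
        glue \<phi> h (Suc k) xs"
      by simp
  qed
  finally show ?case .
qed

lemma catalan_op_in_clone:
  "(2 * n + 1, restrict (catalan_op \<phi> n) (tuples D (2 * n + 1))) \<in> clone D {(3, \<phi>)}"
proof (induction n)
  case 0
  have "restrict (catalan_op \<phi> 0) (tuples D (2 * 0 + 1)) = proj_op D (2 * 0 + 1) 0"
    by (auto simp: proj_op_def)
  moreover have "(2 * 0 + 1, proj_op D (2 * 0 + 1) 0) \<in> clone D {(3, \<phi>)}"
    by (rule clone.projection) simp
  ultimately show ?case by (simp only:)
next
  case (Suc n)
  have "catalan_op \<phi> (Suc n) = glue \<phi> (catalan_op \<phi> n) (2 * n + 2)"
    by (rule ext) simp
  then show ?case
    using glue_in_clone[OF Suc, of "2 * n + 2"]
    by (simp del: glue.simps catalan_op.simps restrict_apply)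
qed

lemma catalan_identities_catalan_op:
  "catalan_identities D (\<lambda>m. restrict (catalan_op \<phi> (m div 2)) (tuples D m))"
  unfolding catalan_identities_def
proof (intro conjI allI ballI impI)
  fix x assume "x \<in> D"
  then show "restrict (catalan_op \<phi> (1 div 2)) (tuples D 1) [x] = x"
    by (simp add: tuples_def)
next
  fix m i :: nat and xs
  assume m: "odd m \<and> 3 \<le> m" and i: "i \<in> {1..m - 1}"
    and xs: "xs \<in> tuples D m" and eq: "xs ! (i - 1) = xs ! i"
  from m obtain q where q: "m = 2 * q + 1"
    by (auto elim: oddE)
  with m obtain n where "q = Suc n"
    by (cases q) auto
  with q have n: "m = 2 * n + 3"
    by simp
  \<comment> \<open>Passage from the 1-based index \<open>i\<close> to the 0-based
    \<open>k\<close>.\<close>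
  obtain k where k: "i = Suc k" "k \<le> 2 * n + 1"
    using i n by (cases i) auto
  have "delete_pair k xs \<in> tuples D (2 * n + 1)"
    using delete_pair_in_tuples[of xs D "2 * n + 1" k] xs k n by (simp add: numeral_3_eq_3)
  then show "restrict (catalan_op \<phi> (m div 2)) (tuples D m) xs =
      restrict (catalan_op \<phi> ((m - 2) div 2)) (tuples D (m - 2))
        (take (i - 1) xs @ drop (i + 1) xs)"
    using catalan_op_diagonal[of xs n k] xs eq k n
    by (simp add: delete_pair_def del: catalan_op.simps)
qed

end

section \<open>The converse and the conclusion\<close>

lemma catalan_identities_imp_malcev:
  assumes "catalan_identities D f" "x \<in> D" "y \<in> D"
  shows "f 3 [x, x, y] = y" "f 3 [y, x, x] = y"
proof -
  have f1: "f 1 [y] = y"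
    using assms by (simp add: catalan_identities_def)
  have f3: "f 3 xs = f 1 (take (i - 1) xs @ drop (i + 1) xs)"
    if "i \<in> {1..2}" "xs \<in> tuples D 3" "xs ! (i - 1) = xs ! i" for i xs
    using assms(1)[unfolded catalan_identities_def, THEN conjunct2, rule_format, of 3 i xs] that
    by simp
  show "f 3 [x, x, y] = y" "f 3 [y, x, x] = y"
    \<comment> \<open>In both cases the two copies of \<open>x\<close> are deleted and
      \<open>f 1 [y]\<close> remains.\<close>
    using f3[of 1 "[x, x, y]"] f3[of 2 "[y, x, x]"] f1 assms(2,3)
    by (simp_all add: tuples_def numeral_2_eq_2)
qed

theorem theorem7p4:
  fixes D :: "'a set"
  shows "(\<forall>\<phi>\<in>operations D 3.
            (\<forall>x\<in>D. \<forall>y\<in>D. \<phi> [x, x, y] = y \<and> \<phi> [y, x, x] = y) \<longrightarrow>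
            (\<exists>f :: nat \<Rightarrow> 'a list \<Rightarrow> 'a.
               (\<forall>m. odd m \<longrightarrow> f m \<in> operations D m \<and> (m, f m) \<in> clone D {(3, \<phi>)}) \<and>
               catalan_identities D f))
       \<and> (\<forall>f :: nat \<Rightarrow> 'a list \<Rightarrow> 'a.
            (\<forall>m. odd m \<longrightarrow> f m \<in> operations D m) \<and> catalan_identities D f \<longrightarrow>
            (\<forall>x\<in>D. \<forall>y\<in>D. f 3 [x, x, y] = y \<and> f 3 [y, x, x] = y))"
proof (intro conjI ballI allI impI)
  fix \<phi> assume "\<phi> \<in> operations D 3"
    and "\<forall>x\<in>D. \<forall>y\<in>D. \<phi> [x, x, y] = y \<and> \<phi> [y, x, x] = y"
  then interpret malcev D \<phi>
    by unfold_locales auto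
  \<comment> \<open>For odd m = 2n + 1 the quotient \<open>m div 2\<close> is n; restricting to
    tuples makes the operation extensional.\<close>
  let ?f = "\<lambda>m. restrict (catalan_op \<phi> (m div 2)) (tuples D m)"
  have clone: "(m, ?f m) \<in> clone D {(3, \<phi>)}" if "odd m" for m
    using catalan_op_in_clone[of "m div 2"] that by simp
  moreover have "?f m \<in> operations D m" if "odd m" for m
    using clone_subset_operations[OF clone[OF that]] \<phi>_op by auto
  ultimately show "\<exists>f. (\<forall>m. odd m \<longrightarrow> f m \<in> operations D m \<and> (m, f m) \<in> clone D {(3, \<phi>)}) \<and>
      catalan_identities D f"
    using catalan_identities_catalan_op by (intro exI[of _ ?f]) blast
qed (auto intro: catalan_identities_imp_malcev)

end
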